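(* Let $P$ be the program QSTPI-TRANS of an instance of the Quota Steiner tree problem with interference (QSTPI), and let $I_{\mathrm{LB}}$ be a valid lower bound on the (optimal value of the) problem MinI of the same instance. Suppose that $I_{\mathrm{LB}}$ is chosen as split value, $I_{\mathrm{split}}:=I_{\mathrm{LB}}$ (where split values are by definition in $\mathbb{R}_{>0}$), and let $P_{\ge}$ be the program obtained from $P$ by adding the constraint $I_{\mathrm{tot}}\ge I_{\mathrm{split}}$. Then any optimal solution $S_{\ge}^*$ of $P_{\ge}$ is also an optimal solution of $P$.
   Context: Instance of QSTPI: a finite undirected graph $G=(V,E)$ whose vertex set is partitioned into fixed terminals $T_f$, potential terminals $T_p$ and Steiner nodes; vertex costs $b:T_p\to\mathbb{R}_{>0}$; quota profits $q:T_p\to\mathbb{R}_{>0}$; a quota $Q\in\mathbb{R}_{>0}$; edge costs $c:E\to\mathbb{R}_{\ge 0}$; interferences $I_{ij}\in\mathbb{R}_{\ge0}$ for distinct $i,j\in T_p$ (the interference experienced by $j$ if $i$ is chosen); distances $d_{ij}\in\mathbb{R}_{\ge0}$ between $i,j\in T_p$; and a minimum distance $D_{\mathrm{min}}$. Transformed digraph: fix a root $r\in T_f$. Replace each edge $e=\{i,j\}\in E$ by the two arcs $(i,j),(j,i)$; the arc $(i,j)$ has cost $c_{ij}=c_e+b_j$ if $j\in T_p$ and $c_{ij}=c_e$ otherwise. For each $i\in T_p$ add a new fixed terminal $i'$ and two arcs $(r,i')$ and $(i,i')$ of cost $0$. Let $V$, $A$, $T_f$ now denote the resulting vertex set, arc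 set and set of fixed terminals (including all $i'$). For $W\subseteq V$ let $\delta^-(W)$ be the set of arcs $(i,j)\in A$ with $i\in V\setminus W$, $j\in W$, and write $x(K)=\sum_{a\in K}x_a$. The program QSTPI-TRANS has binary variables $x_{ij}\in\{0,1\}$ for $(i,j)\in A$ and a real variable $I_{\mathrm{tot}}$, and reads: minimize $c^Tx$ subject to (1) $x(\delta^-(W))\ge 1$ for all $W\subset V$ with $r\notin W$ and $|W\cap T_f|\ge 1$; (2) $\sum_{i\in T_p}q_i x_{ri'}+I_{\mathrm{tot}}\le \sum_{i\in T_p}q_i-Q$; (3) $I_{\mathrm{tot}}\ge\sum_{i\in T_p}\sum_{j\in T_p, j\ne i}I_{ij}\,x_{ii'}x_{jj'}$; (4) $x_{ii'}+x_{jj'}\le 1$ for all $i,j\in T_p$ with $i\neq j$ and $d_{ij}<D_{\mathrm{min}}$. The problem MinI: minimize $I_{\mathrm{tot}}$ over $y\in\{0,1\}^{T_p}$ and $I_{\mathrm{tot}}\in\mathbb{R}_{\ge0}$ subject to (a) $\sum_{i\in T_p}q_iy_i-I_{\mathrm{tot}}\ge Q$; (b) $I_{\mathrm{tot}}\ge\sum_{i\in T_p}\sum_{j\in T_p,\,j>i}(I_{ij}+I_{ji})\,y_jy_i$ (for a fixed total order on $T_p$, i.e. the sum is over unordered pairs); (c) $y_i+y_j\le1$ for all $i,j\in T_p$ with $i\ne j$ and $d_{ij}<D_{\mathrm{min}}$. A valid lower bound on MinI is a real number that is at most the objective value of every feasible solution of MinI. *)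

theory Defs
  imports Complex_Main "HOL-Library.FuncSet"
begin

record 's program =
  feasible :: "'s set"
  objective :: "'s \<Rightarrow> real"

definition optimal_solution :: "'s program \<Rightarrow> 's \<Rightarrow> bool" where
  "optimal_solution P s \<longleftrightarrow> is_arg_min (objective P) (\<lambda>t. t \<in> feasible P) s"

definition add_constraint :: "'s program \<Rightarrow> ('s \<Rightarrow> bool) \<Rightarrow> 's program" where
  "add_constraint P C = P\<lparr>feasible := {s \<in> feasible P. C s}\<rparr>"

definition valid_lower_bound :: "'s program \<Rightarrow> real \<Rightarrow> bool" where
  "valid_lower_bound P l \<longleftrightarrow> (\<forall>s \<in> feasible P. l \<le> objective P s)"

record 'v qstpi =
  vertices :: "'v set"
  edges :: "'v set set"
  fixed_terminals :: "'v set"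
  potential_terminals :: "'v set"
  steiner_nodes :: "'v set"
  vertex_cost :: "'v \<Rightarrow> real"
  profit :: "'v \<Rightarrow> real"
  quota :: real
  edge_cost :: "'v set \<Rightarrow> real"
  interference :: "'v \<Rightarrow> 'v \<Rightarrow> real"
  distance :: "'v \<Rightarrow> 'v \<Rightarrow> real"
  min_distance :: real

text \<open>The value \<open>interference G i j\<close> is the interference experienced by \<open>j\<close> if \<open>i\<close> is chosen.
  It is constrained only for distinct potential terminals and need not be symmetric; no
  symmetry of \<open>distance G\<close> and no sign of \<open>min_distance G\<close> is assumed either.\<close>

definition qstpi_instance :: "'v qstpi \<Rightarrow> bool" where
  "qstpi_instance G \<longleftrightarrow>
     finite (vertices G) \<and>
     (\<forall>e \<in> edges G. e \<subseteq> vertices G \<and> card e = 2) \<and>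
     vertices G = fixed_terminals G \<union> potential_terminals G \<union> steiner_nodes G \<and>
     fixed_terminals G \<inter> potential_terminals G = {} \<and>
     fixed_terminals G \<inter> steiner_nodes G = {} \<and>
     potential_terminals G \<inter> steiner_nodes G = {} \<and>
     (\<forall>i \<in> potential_terminals G. vertex_cost G i > 0) \<and>
     (\<forall>i \<in> potential_terminals G. profit G i > 0) \<and>
     quota G > 0 \<and>
     (\<forall>e \<in> edges G. edge_cost G e \<ge> 0) \<and>
     (\<forall>i \<in> potential_terminals G. \<forall>j \<in> potential_terminals G.
        i \<noteq> j \<longrightarrow> interference G i j \<ge> 0) \<and>
     (\<forall>i \<in> potential_terminals G. \<forall>j \<in> potential_terminals G. distance G i j \<ge> 0)"

text \<open>\<open>Copy i\<close> is the new fixed terminal \<open>i'\<close> added for a potential terminal \<open>i\<close>.\<close>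

datatype 'v tvertex = Orig 'v | Copy 'v

type_synonym 'v arc = "'v tvertex \<times> 'v tvertex"

definition trans_vertices :: "'v qstpi \<Rightarrow> 'v tvertex set" where
  "trans_vertices G = Orig ` vertices G \<union> Copy ` potential_terminals G"

definition trans_terminals :: "'v qstpi \<Rightarrow> 'v tvertex set" where
  "trans_terminals G = Orig ` fixed_terminals G \<union> Copy ` potential_terminals G"

definition trans_arcs :: "'v qstpi \<Rightarrow> 'v \<Rightarrow> 'v arc set" where
  "trans_arcs G r =
     {(Orig i, Orig j) | i j. {i, j} \<in> edges G} \<union>
     {(Orig r, Copy i) | i. i \<in> potential_terminals G} \<union>
     {(Orig i, Copy i) | i. i \<in> potential_terminals G}"

definition trans_cost :: "'v qstpi \<Rightarrow> 'v arc \<Rightarrow> real" where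
  "trans_cost G a =
     (case a of
        (Orig i, Orig j) \<Rightarrow>
          edge_cost G {i, j} + (if j \<in> potential_terminals G then vertex_cost G j else 0)
      | _ \<Rightarrow> 0)"

definition in_cut :: "'v qstpi \<Rightarrow> 'v \<Rightarrow> 'v tvertex set \<Rightarrow> 'v arc set" where
  "in_cut G r W = {(u, v) \<in> trans_arcs G r. u \<in> trans_vertices G - W \<and> v \<in> W}"

text \<open>A solution of QSTPI-TRANS is a pair of the arc variables \<open>x\<close> and the real \<open>I\<^sub>t\<^sub>o\<^sub>t\<close>.
  The arc variables are indexed by exactly the arcs of the transformed digraph; the extensional
  function space makes two solutions equal if and only if they agree on all arcs.\<close>

definition qstpi_trans :: "'v qstpi \<Rightarrow> 'v \<Rightarrow> (('v arc \<Rightarrow> real) \<times> real) program" where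
  "qstpi_trans G r = (let Tp = potential_terminals G in
     \<lparr>feasible = {(x, Itot).
        x \<in> trans_arcs G r \<rightarrow>\<^sub>E {0, 1} \<and>
        (\<forall>W. W \<subset> trans_vertices G \<and> Orig r \<notin> W \<and> card (W \<inter> trans_terminals G) \<ge> 1
           \<longrightarrow> sum x (in_cut G r W) \<ge> 1) \<and>
        (\<Sum>i\<in>Tp. profit G i * x (Orig r, Copy i)) + Itot \<le> (\<Sum>i\<in>Tp. profit G i) - quota G \<and>
        Itot \<ge> (\<Sum>i\<in>Tp. \<Sum>j\<in>Tp - {i}.
                  interference G i j * x (Orig i, Copy i) * x (Orig j, Copy j)) \<and>
        (\<forall>i\<in>Tp. \<forall>j\<in>Tp. i \<noteq> j \<and> distance G i j < min_distance G
           \<longrightarrow> x (Orig i, Copy i) + x (Orig j, Copy j) \<le> 1)},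
      objective = (\<lambda>(x, Itot). \<Sum>a\<in>trans_arcs G r. trans_cost G a * x a)\<rparr>)"

text \<open>The relation \<open>R\<close> is the (reflexive) total order on the potential terminals: the condition
  \<open>(i, j) \<in> R \<and> j \<noteq> i\<close> reads \<open>j > i\<close>.\<close>

definition MinI :: "'v qstpi \<Rightarrow> 'v rel \<Rightarrow> (('v \<Rightarrow> real) \<times> real) program" where
  "MinI G R = (let Tp = potential_terminals G in
     \<lparr>feasible = {(y, Itot).
        y \<in> Tp \<rightarrow>\<^sub>E {0, 1} \<and>
        Itot \<ge> 0 \<and>
        (\<Sum>i\<in>Tp. profit G i * y i) - Itot \<ge> quota G \<and>
        Itot \<ge> (\<Sum>i\<in>Tp. \<Sum>j\<in>{j \<in> Tp. (i, j) \<in> R \<and> j \<noteq> i}.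
                  (interference G i j + interference G j i) * y j * y i) \<and>
        (\<forall>i\<in>Tp. \<forall>j\<in>Tp. i \<noteq> j \<and> distance G i j < min_distance G \<longrightarrow> y i + y j \<le> 1)},
      objective = (\<lambda>(y, Itot). Itot)\<rparr>)"

end

theory Submission imports Defs begin

text \<open>
  The added constraint \<open>Itot \<ge> I_split\<close> cuts off nothing: every feasible solution \<open>(x, Itot)\<close> of
  QSTPI-TRANS already has \<open>Itot \<ge> I_LB\<close>, so both programs have the same feasible set and the same
  objective, hence the same optimal solutions.

  The bound holds because \<open>y\<^sub>i = x(i, i')\<close> turns \<open>(x, Itot)\<close> into a feasible solution of MinI with
  the same value of \<open>Itot\<close>. The only arcs into a new terminal \<open>i'\<close> come from \<open>r\<close> and from \<open>i\<close>, so
  the cut constraint for \<open>W = {i'}\<close> reads \<open>x(r, i') + x(i, i') \<ge> 1\<close>. Thus the profits that are not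
  written off on an arc \<open>(r, i')\<close> are all collected by \<open>y\<close>, and the profit constraint of QSTPI-TRANS,
  which bounds the profits forgone, becomes the quota constraint of MinI. The interference terms of
  the two programs agree once the sum over ordered pairs is regrouped into a sum over unordered
  pairs; being nonnegative, they also give \<open>Itot \<ge> 0\<close>.
\<close>

text \<open>Every \<open>j \<noteq> i\<close> lies either above or below \<open>i\<close>; exchanging the summations turns the sum
  over the pairs with \<open>j\<close> below \<open>i\<close> into one over the pairs with \<open>j\<close> above \<open>i\<close>, with the
  arguments of \<open>f\<close> swapped.\<close>

lemma sum_distinct_pairs_linear_order:
  fixes f :: "'a \<Rightarrow> 'a \<Rightarrow> 'b :: comm_monoid_add"
  assumes fin: "finite A" and lin: "linear_order_on A R"
  shows "(\<Sum>i\<in>A. \<Sum>j\<in>A - {i}. f i j)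
       = (\<Sum>i\<in>A. \<Sum>j\<in>{j \<in> A. (i, j) \<in> R \<and> j \<noteq> i}. f i j + f j i)"
proof -
  let ?above = "\<lambda>i. {j \<in> A. (i, j) \<in> R \<and> j \<noteq> i}"
  let ?below = "\<lambda>i. {j \<in> A. (j, i) \<in> R \<and> j \<noteq> i}"
  have total: "total_on A R" and anti: "antisym R"
    using lin by (auto simp: linear_order_on_def partial_order_on_def)
  have split: "A - {i} = ?above i \<union> ?below i" if "i \<in> A" for i
    using total that unfolding total_on_def by blast
  have disj: "?above i \<inter> ?below i = {}" for i
    using anti unfolding antisym_def by blast
  have "(\<Sum>i\<in>A. \<Sum>j\<in>A - {i}. f i j)
      = (\<Sum>i\<in>A. (\<Sum>j\<in>?above i. f i j) + (\<Sum>j\<in>?below i. f i j))"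
  proof (rule sum.cong[OF refl])
    fix i assume "i \<in> A"
    show "(\<Sum>j\<in>A - {i}. f i j) = (\<Sum>j\<in>?above i. f i j) + (\<Sum>j\<in>?below i. f i j)"
      unfolding split[OF \<open>i \<in> A\<close>] using fin disj by (intro sum.union_disjoint) auto
  qed
  also have "\<dots> = (\<Sum>i\<in>A. \<Sum>j\<in>?above i. f i j) + (\<Sum>i\<in>A. \<Sum>j\<in>?below i. f i j)"
    by (rule sum.distrib)
  also have "(\<Sum>i\<in>A. \<Sum>j\<in>?below i. f i j) = (\<Sum>j\<in>A. \<Sum>i\<in>{i \<in> A. (j, i) \<in> R \<and> j \<noteq> i}. f i j)"
    using fin by (intro sum.swap_restrict)
  also have "\<dots> = (\<Sum>i\<in>A. \<Sum>j\<in>?above i. f j i)"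
    by (intro sum.cong) auto
  finally show ?thesis by (simp add: sum.distrib)
qed

lemma in_cut_singleton_Copy:
  assumes "r \<in> vertices G" "i \<in> vertices G" "i \<in> potential_terminals G"
  shows "in_cut G r {Copy i} = {(Orig r, Copy i), (Orig i, Copy i)}"
  using assms by (auto simp: in_cut_def trans_arcs_def trans_vertices_def)

text \<open>The cut constraint for the single new terminal \<open>i'\<close>: a potential terminal is collected, or
  its profit is written off on the arc from the root, or both.\<close>

lemma qstpi_trans_collected_or_forgone:
  assumes inst: "qstpi_instance G" and r: "r \<in> fixed_terminals G"
    and feas: "(x, Itot) \<in> feasible (qstpi_trans G r)"
    and i: "i \<in> potential_terminals G"
  shows "1 \<le> x (Orig r, Copy i) + x (Orig i, Copy i)"
proof -
  have rV: "r \<in> vertices G" and iV: "i \<in> vertices G" and "r \<noteq> i"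
    using inst r i by (auto simp: qstpi_instance_def)
  have "{Copy i} \<subset> trans_vertices G"
    using rV i by (auto simp: trans_vertices_def)
  moreover have "{Copy i} \<inter> trans_terminals G = {Copy i}"
    using i by (auto simp: trans_terminals_def)
  ultimately have "1 \<le> sum x (in_cut G r {Copy i})"
    using feas unfolding qstpi_trans_def Let_def by simp
  then show ?thesis
    using \<open>r \<noteq> i\<close> by (simp add: in_cut_singleton_Copy[OF rV iV i])
qed

lemma qstpi_trans_feasible_imp_MinI_feasible:
  assumes inst: "qstpi_instance G" and r: "r \<in> fixed_terminals G"
    and lin: "linear_order_on (potential_terminals G) R"
    and feas: "(x, Itot) \<in> feasible (qstpi_trans G r)"
  shows "(\<lambda>i\<in>potential_terminals G. x (Orig i, Copy i), Itot) \<in> feasible (MinI G R)"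
proof -
  define Tp where "Tp = potential_terminals G"
  define y where "y = (\<lambda>i\<in>Tp. x (Orig i, Copy i))"
  have y: "y i = x (Orig i, Copy i)" if "i \<in> Tp" for i
    using that by (simp add: y_def)
  have fin: "finite Tp"
    using inst by (auto simp: qstpi_instance_def Tp_def)
  have profit: "profit G i > 0" if "i \<in> Tp" for i
    using inst that by (auto simp: qstpi_instance_def Tp_def)
  have interf: "interference G i j \<ge> 0" if "i \<in> Tp" "j \<in> Tp" "i \<noteq> j" for i j
    using inst that by (auto simp: qstpi_instance_def Tp_def)
  have x01: "x \<in> trans_arcs G r \<rightarrow>\<^sub>E {0, 1}"
    and forgone: "(\<Sum>i\<in>Tp. profit G i * x (Orig r, Copy i)) + Itot
                    \<le> (\<Sum>i\<in>Tp. profit G i) - quota G"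
    and Itot: "(\<Sum>i\<in>Tp. \<Sum>j\<in>Tp - {i}.
                  interference G i j * x (Orig i, Copy i) * x (Orig j, Copy j)) \<le> Itot"
    and apart: "\<forall>i\<in>Tp. \<forall>j\<in>Tp. i \<noteq> j \<and> distance G i j < min_distance G
                  \<longrightarrow> x (Orig i, Copy i) + x (Orig j, Copy j) \<le> 1"
    using feas by (simp_all add: qstpi_trans_def Let_def Tp_def)
  have "(Orig i, Copy i) \<in> trans_arcs G r" if "i \<in> Tp" for i
    using that by (auto simp: trans_arcs_def Tp_def)
  then have y01: "y \<in> Tp \<rightarrow>\<^sub>E {0, 1}"
    using PiE_mem[OF x01] unfolding y_def restrict_PiE_iff by simp
  then have y_nonneg: "y i \<ge> 0" if "i \<in> Tp" for i
    using that by (auto dest: PiE_mem)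
  have "(\<Sum>i\<in>Tp. profit G i)
      \<le> (\<Sum>i\<in>Tp. profit G i * x (Orig r, Copy i) + profit G i * y i)"
  proof (rule sum_mono)
    fix i assume i: "i \<in> Tp"
    have "1 \<le> x (Orig r, Copy i) + y i"
      using qstpi_trans_collected_or_forgone[OF inst r feas] i by (simp add: y Tp_def)
    then have "profit G i * 1 \<le> profit G i * (x (Orig r, Copy i) + y i)"
      using profit[OF i] by (intro mult_left_mono) auto
    then show "profit G i \<le> profit G i * x (Orig r, Copy i) + profit G i * y i"
      by (simp add: distrib_left)
  qed
  then have quota: "quota G \<le> (\<Sum>i\<in>Tp. profit G i * y i) - Itot"
    using forgone by (simp add: sum.distrib)
  have Itot_y: "(\<Sum>i\<in>Tp. \<Sum>j\<in>Tp - {i}. interference G i j * y i * y j) \<le> Itot"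
  proof -
    have "(\<Sum>i\<in>Tp. \<Sum>j\<in>Tp - {i}. interference G i j * y i * y j)
        = (\<Sum>i\<in>Tp. \<Sum>j\<in>Tp - {i}.
             interference G i j * x (Orig i, Copy i) * x (Orig j, Copy j))"
      by (intro sum.cong refl) (auto simp: y)
    then show ?thesis using Itot by simp
  qed
  have "0 \<le> (\<Sum>i\<in>Tp. \<Sum>j\<in>Tp - {i}. interference G i j * y i * y j)"
    using interf y_nonneg by (intro sum_nonneg mult_nonneg_nonneg) auto
  then have Itot_nonneg: "0 \<le> Itot"
    using Itot_y by linarith
  have "(\<Sum>i\<in>Tp. \<Sum>j\<in>Tp - {i}. interference G i j * y i * y j)
      = (\<Sum>i\<in>Tp. \<Sum>j\<in>{j \<in> Tp. (i, j) \<in> R \<and> j \<noteq> i}.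
           (interference G i j + interference G j i) * y j * y i)"
    using sum_distinct_pairs_linear_order[OF fin lin[folded Tp_def],
        of "\<lambda>i j. interference G i j * y i * y j"]
    by (simp add: algebra_simps)
  then have "(y, Itot) \<in> feasible (MinI G R)"
    using y01 quota Itot_y Itot_nonneg apart
    by (simp add: MinI_def Let_def y flip: Tp_def)
  then show ?thesis by (simp add: y_def Tp_def)
qed

lemma add_constraint_redundant:
  assumes "\<And>s. s \<in> feasible P \<Longrightarrow> C s"
  shows "add_constraint P C = P"
proof -
  have "{s \<in> feasible P. C s} = feasible P" using assms by blast
  then show ?thesis by (simp add: add_constraint_def)
qed

theorem corollary4p3:
  fixes G :: "'v qstpi" and r :: 'v and R :: "'v rel"
    and I_LB I_split :: real
    and S :: "('v arc \<Rightarrow> real) \<times> real"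
  assumes "qstpi_instance G"
    and "r \<in> fixed_terminals G"
    and "linear_order_on (potential_terminals G) R"
    and "valid_lower_bound (MinI G R) I_LB"
    and "I_split = I_LB"
    and "I_split > 0"
    and "optimal_solution (add_constraint (qstpi_trans G r) (\<lambda>(x, Itot). Itot \<ge> I_split)) S"
  shows "optimal_solution (qstpi_trans G r) S"
proof -
  have "objective (MinI G R) (y, Itot) = Itot" for y Itot
    by (simp add: MinI_def Let_def)
  then have "I_split \<le> Itot" if "(x, Itot) \<in> feasible (qstpi_trans G r)" for x Itot
    using qstpi_trans_feasible_imp_MinI_feasible[OF assms(1-3) that] assms(4,5)
    unfolding valid_lower_bound_def by metis
  then have "add_constraint (qstpi_trans G r) (\<lambda>(x, Itot). Itot \<ge> I_split) = qstpi_trans G r"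
    by (intro add_constraint_redundant) auto
  then show ?thesis using assms(7) by simp
qed

end
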